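(* Let $b$ be an integer such that $-b$ is not the square of an integer. Then infinitely many terms of the sequence $(P_n)_{n\ge 1}$, $P_n=n^2+b$, do not have a primitive divisor; that is, there are infinitely many positive integers $n$ such that $P_n$ has no primitive divisor.
   Context: Let $(A_n)_{n\ge 1}$ be a sequence with integer terms. An integer $d>1$ is called a primitive divisor of the term $A_n$ if (1) $d\mid A_n$, and (2) $\gcd(d,A_m)=1$ for all non-zero terms $A_m$ with $m<n$. Here the sequence is $A_n=P_n=n^2+b$, indexed by the positive integers $n$. *)

theory Defs
  imports Main
begin

(* A sequence (A_n) with n \<ge> 1 is a function on nat whose value at 0 is not a term;
   hence m ranges over 1 \<le> m < n only. *)
definition primitive_divisor :: "(nat \<Rightarrow> int) \<Rightarrow> nat \<Rightarrow> int \<Rightarrow> bool" where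
  "primitive_divisor A n d \<longleftrightarrow>
     d > 1 \<and> d dvd A n \<and> (\<forall>m. 1 \<le> m \<and> m < n \<and> A m \<noteq> 0 \<longrightarrow> gcd d (A m) = 1)"

definition quad_seq :: "int \<Rightarrow> nat \<Rightarrow> int" where
  "quad_seq b n = (int n)^2 + b"

end

theory Submission
  imports Defs "HOL-Computational_Algebra.Primes" "HOL-Library.Infinite_Set"
begin

text \<open>
  If a prime \<open>p\<close> divides \<open>n\<^sup>2 + b\<close>, it also divides \<open>m\<^sup>2 + b\<close> for \<open>m = \<bar>p - n\<bar>\<close>, because
  \<open>m \<equiv> \<plusminus>n\<close> modulo \<open>p\<close>. This index \<open>m\<close> lies strictly between \<open>0\<close> and \<open>n\<close> as soon as \<open>p < 2n\<close> and
  \<open>p \<noteq> n\<close>, and \<open>p = n\<close> would force \<open>n\<close> to divide \<open>b\<close>. Since \<open>-b\<close> is not a square, \<open>b\<close> and all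
  terms are non-zero: every earlier term counts in the definition of a primitive divisor, and
  \<open>n\<close> cannot divide \<open>b\<close> once it exceeds \<open>\<bar>b\<bar>\<close>. So for \<open>n > \<bar>b\<bar>\<close> a term all of whose prime
  factors are below \<open>2n\<close> has no primitive divisor (lemma \<open>no_primitive_divisor_if_smooth\<close>).

  Infinitely many such terms come from the identity
  \<open>(k\<^sup>2 + b) ((k + 1)\<^sup>2 + b) = (k\<^sup>2 + k + b)\<^sup>2 + b\<close>, the multiplicativity of the norm
  form \<open>x\<^sup>2 + b y\<^sup>2\<close>: at the index \<open>N = k\<^sup>2 + k + b\<close> the term splits into two factors, each of
  size about \<open>N\<close>, hence below \<open>2N\<close> for large \<open>k\<close>.
\<close>

lemma earlier_term_divisible:
  fixes b p :: int and n :: nat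
  assumes "p > 0" "p < 2 * int n" "p \<noteq> int n" "p dvd quad_seq b n"
  obtains m where "1 \<le> m" "m < n" "p dvd quad_seq b m"
proof
  let ?m = "nat \<bar>p - int n\<bar>"
  show "1 \<le> ?m" "?m < n"
    using assms by linarith+
  have "quad_seq b ?m = p * (p - 2 * int n) + quad_seq b n"
    by (simp add: quad_seq_def power2_eq_square algebra_simps)
  then show "p dvd quad_seq b ?m"
    using assms(4) by simp
qed

lemma no_primitive_divisor_if_smooth:
  fixes b :: int and n :: nat
  assumes nonzero: "\<And>m. quad_seq b m \<noteq> 0"
    and large: "\<bar>b\<bar> < int n"
    and smooth: "\<And>p. prime p \<Longrightarrow> p dvd quad_seq b n \<Longrightarrow> p < 2 * int n"
  shows "\<not> primitive_divisor (quad_seq b) n d"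
proof
  assume d: "primitive_divisor (quad_seq b) n d"
  then have "\<not> is_unit d"
    by (auto simp: primitive_divisor_def)
  then obtain p where p: "prime p" "p dvd d"
    using d prime_divisor_exists[of d] by (auto simp: primitive_divisor_def)
  have p_dvd: "p dvd quad_seq b n"
    using p d dvd_trans by (auto simp: primitive_divisor_def)
  have "p \<noteq> int n"
  proof
    assume "p = int n"
    then have "int n dvd b"
      using p_dvd by (simp add: quad_seq_def power2_eq_square dvd_add_right_iff)
    moreover have "b \<noteq> 0"
      using nonzero[of 0] by (simp add: quad_seq_def)
    ultimately show False
      using large dvd_imp_le_int[of b "int n"] by simp
  qed
  then obtain m where m: "1 \<le> m" "m < n" "p dvd quad_seq b m"
    using earlier_term_divisible[of p n b] p_dvd smooth[of p] p(1) prime_gt_0_int by metis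
  then have "gcd d (quad_seq b m) = 1"
    using d nonzero by (auto simp: primitive_divisor_def)
  then have "p dvd 1"
    using p(2) m(3) gcd_greatest by metis
  then show False
    using p(1) not_prime_unit by blast
qed

theorem theorem1p2:
  fixes b :: int
  assumes "\<not> (\<exists>k::int. - b = k^2)"
  shows "infinite {n::nat. n \<ge> 1 \<and> \<not> (\<exists>d. primitive_divisor (quad_seq b) n d)}"
  unfolding infinite_nat_iff_unbounded_le
proof
  fix M :: nat
  \<comment> \<open>The summand \<open>\<bar>b\<bar> + 2\<close> gives \<open>k\<^sup>2 + b > 1\<close>, which is exactly what makes
      \<open>(k + 1)\<^sup>2 + b < 2N\<close>; the summand \<open>M\<close> pushes \<open>N\<close> beyond the given bound.\<close>
  define k :: int where "k = \<bar>b\<bar> + int M + 2"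
  define N :: nat where "N = nat (k\<^sup>2 + k + b)"
  have "2 * k \<le> k\<^sup>2"
    unfolding power2_eq_square by (rule mult_right_mono) (auto simp: k_def)
  then have N: "int N = k\<^sup>2 + k + b" and N_gt: "k < int N" and factor_gt: "1 < k\<^sup>2 + b"
    by (auto simp: N_def k_def)
  have factorization: "quad_seq b N = (k\<^sup>2 + b) * ((k + 1)\<^sup>2 + b)"
    unfolding quad_seq_def N by (simp add: power2_eq_square algebra_simps)
  have "\<not> primitive_divisor (quad_seq b) N d" for d
  proof (rule no_primitive_divisor_if_smooth)
    show "quad_seq b m \<noteq> 0" for m
      using assms by (auto simp: quad_seq_def add_eq_0_iff)
    show "\<bar>b\<bar> < int N"
      using N_gt by (simp add: k_def)
    fix p :: int
    assume p: "prime p" "p dvd quad_seq b N"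
    have second: "(k + 1)\<^sup>2 + b = k\<^sup>2 + b + 2 * k + 1"
      by (simp add: power2_eq_square algebra_simps)
    have k_pos: "0 < k"
      by (simp add: k_def)
    from p factorization have "p dvd k\<^sup>2 + b \<or> p dvd (k + 1)\<^sup>2 + b"
      by (simp add: prime_dvd_mult_iff)
    then have "p \<le> k\<^sup>2 + b \<or> p \<le> (k + 1)\<^sup>2 + b"
      using zdvd_imp_le[of p] factor_gt second k_pos by force
    then show "p < 2 * int N"
      using N factor_gt second k_pos by linarith
  qed
  moreover have "M \<le> N" "1 \<le> N"
    using N_gt by (auto simp: k_def)
  ultimately show "\<exists>n\<ge>M. n \<in> {n. n \<ge> 1 \<and> \<not> (\<exists>d. primitive_divisor (quad_seq b) n d)}"
    by auto
qed

end
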